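(* Let $\alpha$ be a real number with $|\alpha|\le1$, $\alpha\ne-1$. Suppose that $\phi$ and $\omega$ are Schwarz functions, that $\omega$ is an inner function, and that $\psi=\frac{1+\alpha\omega}{1-\omega}$. Then $C_{\psi,\phi}$ preserves the class $\mathcal{P}_\alpha$ if and only if $\phi$ is identically zero.
   Context: $\mathbb{D}=\{z\in\mathbb{C}:|z|<1\}$ and $\mathcal{H}(\mathbb{D})$ is the set of analytic functions on $\mathbb{D}$. A Schwarz function is an analytic function $\omega:\mathbb{D}\to\mathbb{D}$ with $\omega(0)=0$. An analytic function $f$ on $\mathbb{D}$ is inner if $|f(z)|\le1$ for all $z\in\mathbb{D}$ and its radial limits satisfy $|f(\zeta)|=1$ for almost every $\zeta$ with $|\zeta|=1$. For $f,g\in\mathcal{H}(\mathbb{D})$, $f\prec g$ means $f=g\circ\omega$ for some Schwarz function $\omega$. For $|\alpha|\le1$, $\alpha\neq-1$, put $h_\alpha(z)=\frac{1+\alpha z}{1-z}$ and $\mathcal{P}_\alpha=\{f\in\mathcal{H}(\mathbb{D}): f\prec h_\alpha\}$. For $\psi\in\mathcal{H}(\mathbb{D})$ and an analytic self-map $\phi$ of $\mathbb{D}$, $C_{\psi,\phi}(f)=\psi\,(f\circ\phi)$ for $f\in\mathcal{H}(\mathbb{D})$. It preserves $\mathcal{P}_\alpha$ if $C_{\psi,\phi}(\mathcal{P}_\alpha)\subset\mathcal{P}_\alpha$. *)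

theory Defs
  imports "HOL-Analysis.Analysis"
begin

abbreviation unit_disc :: "complex set" where
  "unit_disc \<equiv> ball 0 1"

text \<open>
  Functions on the disc are total functions on the complex plane, of which only the
  values on \<^term>\<open>unit_disc\<close> matter: every notion below constrains them there only.
\<close>

definition schwarz_function :: "(complex \<Rightarrow> complex) \<Rightarrow> bool" where
  "schwarz_function w \<longleftrightarrow>
     w holomorphic_on unit_disc \<and> w ` unit_disc \<subseteq> unit_disc \<and> w 0 = 0"

text \<open>
  The unit circle is parametrised by arc length, so ``almost every point of the circle''
  is taken with respect to Lebesgue measure on the interval of angles.
\<close>

definition inner_function :: "(complex \<Rightarrow> complex) \<Rightarrow> bool" where
  "inner_function f \<longleftrightarrow>
     f holomorphic_on unit_disc \<and> (\<forall>z\<in>unit_disc. norm (f z) \<le> 1) \<and>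
     (AE t in lebesgue_on {0..2 * pi}.
        \<exists>l. ((\<lambda>r. f (of_real r * cis t)) \<longlongrightarrow> l) (at_left 1) \<and> norm l = 1)"

definition subordinate :: "(complex \<Rightarrow> complex) \<Rightarrow> (complex \<Rightarrow> complex) \<Rightarrow> bool" where
  "subordinate f g \<longleftrightarrow> (\<exists>w. schwarz_function w \<and> (\<forall>z\<in>unit_disc. f z = g (w z)))"

definition h_fun :: "complex \<Rightarrow> complex \<Rightarrow> complex" where
  "h_fun \<alpha> z = (1 + \<alpha> * z) / (1 - z)"

definition P_class :: "complex \<Rightarrow> (complex \<Rightarrow> complex) set" where
  "P_class \<alpha> = {f. f holomorphic_on unit_disc \<and> subordinate f (h_fun \<alpha>)}"

definition weighted_comp ::
  "(complex \<Rightarrow> complex) \<Rightarrow> (complex \<Rightarrow> complex) \<Rightarrow> (complex \<Rightarrow> complex) \<Rightarrow> complex \<Rightarrow> complex" where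
  "weighted_comp \<psi> \<phi> f = (\<lambda>z. \<psi> z * f (\<phi> z))"

definition preserves_P_class :: "(complex \<Rightarrow> complex) \<Rightarrow> (complex \<Rightarrow> complex) \<Rightarrow> complex \<Rightarrow> bool" where
  "preserves_P_class \<psi> \<phi> \<alpha> \<longleftrightarrow> weighted_comp \<psi> \<phi> ` P_class \<alpha> \<subseteq> P_class \<alpha>"

end

theory Submission
  imports Defs "HOL-Complex_Analysis.Complex_Analysis"
begin

text \<open>
  Testing the preservation property on the functions \<open>z \<mapsto> h\<^sub>\<alpha> (\<eta> z)\<close> with \<open>\<bar>\<eta>\<bar> = 1\<close> and
  choosing the worst \<open>\<eta>\<close> at each point yields the pointwise estimate
  \<open>(1 + \<alpha>)\<^sup>2 \<bar>\<phi>\<bar> \<bar>1 - \<omega>\<bar> \<bar>1 + \<omega>\<bar>\<^sup>2 \<le> 16 (1 - \<bar>\<omega>\<bar>\<^sup>2)\<close> on the disc. Since \<open>\<omega>\<close> is inner, the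
  bounded holomorphic function \<open>\<phi> (1 - \<omega>) (1 + \<omega>)\<^sup>2\<close> has radial limit \<open>0\<close> almost everywhere,
  so it vanishes identically, and \<open>1 \<plusminus> \<omega>\<close> has no zeros in the disc.
\<close>

section \<open>Geometry of the Moebius map \<open>h_fun \<alpha>\<close> on the disc and a pointwise
  estimate\<close>

lemma norm_lt_1_imp_neq:
  fixes a :: complex
  assumes "norm a < 1"
  shows "1 - a \<noteq> 0" "1 + a \<noteq> 0"
proof -
  show "1 - a \<noteq> 0" using assms by auto
  show "1 + a \<noteq> 0"
    using assms by (metis add.commute add_eq_0_iff norm_minus_cancel norm_one less_irrefl)
qed

text \<open>Since \<open>h_fun \<alpha> a = (1 - \<alpha>) / 2 + (1 + \<alpha>) / 2 * ((1 + a) / (1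
  - a))\<close>, this reduces to the Poisson kernel identity for the real part of
  \<open>(1 + a) / (1 - a)\<close>. Multiplying out \<open>(norm (1 - a))\<^sup>2\<close> keeps it
  free of division.\<close>

lemma Re_h_fun:
  fixes \<alpha> :: real
  assumes "norm a < 1"
  shows "Re (h_fun \<alpha> a) * (norm (1 - a))\<^sup>2 =
           (1 - \<alpha>) / 2 * (norm (1 - a))\<^sup>2 + (1 + \<alpha>) / 2 * (1 - (norm a)\<^sup>2)"
proof -
  have nz: "(Re (1 - a))\<^sup>2 + (Im (1 - a))\<^sup>2 \<noteq> 0"
    using norm_lt_1_imp_neq(1)[OF assms] by (metis complex_neq_0 less_irrefl)
  have "Re (h_fun \<alpha> a) * (norm (1 - a))\<^sup>2 = (1 + \<alpha> * Re a) * (1 - Re a) - \<alpha> * (Im a)\<^sup>2"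
    using nz unfolding h_fun_def Re_divide cmod_power2 by (simp add: power2_eq_square)
  then show ?thesis
    unfolding cmod_power2 by (simp add: power2_eq_square field_simps)
qed

lemma Re_h_fun_ge:
  fixes \<alpha> :: real
  assumes "-1 \<le> \<alpha>" and "norm a < 1"
  shows "(1 - \<alpha>) / 2 \<le> Re (h_fun \<alpha> a)"
proof -
  have "0 \<le> (1 + \<alpha>) / 2 * (1 - (norm a)\<^sup>2)"
    using assms by (simp add: abs_square_le_1)
  then have "(1 - \<alpha>) / 2 * (norm (1 - a))\<^sup>2 \<le> Re (h_fun \<alpha> a) * (norm (1 - a))\<^sup>2"
    unfolding Re_h_fun[OF assms(2)] by linarith
  then show ?thesis
    using norm_lt_1_imp_neq(1)[OF assms(2)] by simp
qed

text \<open>A Moebius map sends circles to circles: the image of \<open>norm w = r\<close> has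
  centre \<open>(1 + \<alpha> * r\<^sup>2) / (1 - r\<^sup>2)\<close> and radius
  \<open>(1 + \<alpha>) * r / (1 - r\<^sup>2)\<close>. The point in direction \<open>-u\<close> from
  the centre can thus be prescribed.\<close>

lemma h_fun_circle_image:
  fixes \<alpha> r :: real and u :: complex
  assumes "norm u = 1" and "0 \<le> r" and "r < 1"
  obtains w where "norm w = r"
    and "h_fun \<alpha> w = (1 + \<alpha> * r\<^sup>2 - (1 + \<alpha>) * r * u) / (1 - r\<^sup>2)"
proof
  \<comment> \<open>This is the preimage of the prescribed point; its modulus is \<open>r\<close>
    because \<open>norm (r - u) = norm (1 - r * u)\<close> on the unit circle.\<close>
  define w where "w = r * (r - u) / (1 - r * u)"
  have "norm (r * u) < 1" using assms by (simp add: norm_mult)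
  then have d: "1 - r * u \<noteq> 0" by (rule norm_lt_1_imp_neq)
  have u: "(Re u)\<^sup>2 + (Im u)\<^sup>2 = 1" using assms(1) cmod_power2[of u] by simp
  have "(norm (r - u))\<^sup>2 = (norm (1 - r * u))\<^sup>2"
    unfolding cmod_power2 using u by simp algebra
  then have "norm (r - u) = norm (1 - r * u)"
    by simp
  then show "norm w = r"
    using d assms(2) by (simp add: w_def norm_mult norm_divide)
  have "r\<^sup>2 < 1" using assms by (simp add: abs_square_less_1)
  then have r2: "1 - (of_real r)\<^sup>2 \<noteq> (0::complex)"
    by (metis eq_iff_diff_eq_0 less_irrefl of_real_eq_iff of_real_1 of_real_power)
  have "1 + \<alpha> * w = (1 + \<alpha> * r\<^sup>2 - (1 + \<alpha>) * r * u) / (1 - r * u)"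
    using d by (simp add: w_def field_simps power2_eq_square)
  moreover have "1 - w = (1 - r\<^sup>2) / (1 - r * u)"
    using d by (simp add: w_def field_simps power2_eq_square)
  ultimately show "h_fun \<alpha> w = (1 + \<alpha> * r\<^sup>2 - (1 + \<alpha>) * r * u) / (1 - r\<^sup>2)"
    using d r2 by (simp add: h_fun_def)
qed

lemma h_fun_product_bound:
  fixes \<alpha> :: real
  assumes \<alpha>: "\<bar>\<alpha>\<bar> \<le> 1" "\<alpha> \<noteq> -1" and a: "norm a < 1" and r: "0 \<le> r" "r < 1"
    and le: "\<And>w. norm w = r \<Longrightarrow> (1 - \<alpha>) / 2 \<le> Re (h_fun \<alpha> a * h_fun \<alpha> w)"
  shows "(1 + \<alpha>)\<^sup>2 * (r * norm (1 - a) * (norm (1 + a))\<^sup>2) \<le> 16 * (1 - (norm a)\<^sup>2)"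
proof -
  define p where "p = h_fun \<alpha> a"
  \<comment> \<open>The half-plane containing the values of \<open>h_fun \<alpha>\<close> is bounded
    by real part \<open>\<beta>\<close>, and \<open>\<kappa>\<close> scales
    \<open>(1 + z) / (1 - z)\<close> onto it.\<close>
  define \<beta> \<kappa> n m q s where "\<beta> = (1 - \<alpha>) / 2" and "\<kappa> = (1 + \<alpha>) / 2"
    and "n = norm (1 - a)" and "m = norm (1 + a)" and "q = norm (1 + \<alpha> * a)"
    and "s = 1 - (norm a)\<^sup>2"
  have \<kappa>: "\<kappa> > 0" and \<beta>: "0 \<le> \<beta>" "\<beta> \<le> 1" using \<alpha> by (auto simp: \<kappa>_def \<beta>_def)
  have n: "n > 0" using norm_lt_1_imp_neq(1)[OF a] by (simp add: n_def)
  have s: "s \<ge> 0" using a by (simp add: s_def abs_square_le_1)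
  have r2: "1 - r\<^sup>2 > 0" using r by (simp add: abs_square_less_1)
  have np: "norm p = q / n" by (simp add: p_def h_fun_def norm_divide q_def n_def)

  \<comment> \<open>the direction for which \<open>p * h_fun \<alpha> w\<close> has minimal real part among \<open>norm w = r\<close>\<close>
  define u where "u = (if p = 0 then 1 else cnj p / norm p)"
  \<comment> \<open>The default value 1 in \<open>u\<close> gives this without first showing
    \<open>p \<noteq> 0\<close>.\<close>
  have nu: "norm u = 1" by (simp add: u_def norm_divide)
  have pu: "p * u = norm p"
    by (simp add: u_def complex_norm_square[symmetric] power2_eq_square)
  obtain w where w: "norm w = r" "h_fun \<alpha> w = (1 + \<alpha> * r\<^sup>2 - (1 + \<alpha>) * r * u) / (1 - r\<^sup>2)"
    using h_fun_circle_image[OF nu r] .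
  have "p * h_fun \<alpha> w = ((1 + \<alpha> * r\<^sup>2) * p - (1 + \<alpha>) * r * (p * u)) / (1 - r\<^sup>2)"
    unfolding w(2) by (simp add: algebra_simps)
  also have "\<dots> = (complex_of_real (1 + \<alpha> * r\<^sup>2) * p - complex_of_real ((1 + \<alpha>) * r * norm p))
      / complex_of_real (1 - r\<^sup>2)"
    unfolding pu by simp
  finally have "Re (p * h_fun \<alpha> w) = ((1 + \<alpha> * r\<^sup>2) * Re p - (1 + \<alpha>) * r * norm p) / (1 - r\<^sup>2)"
    by (simp only: Re_divide_of_real minus_complex.sel Re_complex_of_real
        times_complex.sel Im_complex_of_real) simp
  then have "\<beta> \<le> ((1 + \<alpha> * r\<^sup>2) * Re p - (1 + \<alpha>) * r * norm p) / (1 - r\<^sup>2)"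
    using le[OF w(1)] by (simp add: p_def \<beta>_def)
  then have "\<beta> * (1 - r\<^sup>2) \<le> (1 + \<alpha> * r\<^sup>2) * Re p - (1 + \<alpha>) * r * norm p"
    using r2 by (simp add: field_simps)
  then have "\<beta> * (1 - r\<^sup>2) * n\<^sup>2 \<le> ((1 + \<alpha> * r\<^sup>2) * Re p - (1 + \<alpha>) * r * norm p) * n\<^sup>2"
    by (rule mult_right_mono) simp
  also have "\<dots> = (1 + \<alpha> * r\<^sup>2) * (Re p * n\<^sup>2) - (1 + \<alpha>) * r * q * n"
    unfolding np using n by (simp add: field_simps power2_eq_square)
  also have "Re p * n\<^sup>2 = \<beta> * n\<^sup>2 + \<kappa> * s"
    using Re_h_fun[OF a, of \<alpha>] by (simp add: p_def n_def \<beta>_def \<kappa>_def s_def)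
  \<comment> \<open>The terms \<open>\<beta> * n\<^sup>2\<close> without \<open>r\<close> cancel,
    and \<open>1 + \<alpha> = 2 * \<kappa>\<close> makes \<open>\<kappa>\<close> a common
    factor.\<close>
  finally have "\<kappa> * (2 * r * q * n) \<le> \<kappa> * (2 * \<beta> * n\<^sup>2 * r\<^sup>2 + (1 + \<alpha> * r\<^sup>2) * s)"
    by (simp add: \<kappa>_def field_simps)
  then have "2 * r * q * n \<le> 2 * \<beta> * n\<^sup>2 * r\<^sup>2 + (1 + \<alpha> * r\<^sup>2) * s"
    using \<kappa> by simp
  \<comment> \<open>Weakening \<open>r\<^sup>2\<close> to \<open>r\<close> lets \<open>r * n\<close>
    factor out and leaves the difference \<open>q - \<beta> * n\<close>.\<close>
  also have "\<dots> \<le> 2 * \<beta> * n\<^sup>2 * r + 2 * s"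
  proof (rule add_mono)
    have "r\<^sup>2 \<le> r" using r by (simp add: power2_eq_square mult_left_le)
    then show "2 * \<beta> * n\<^sup>2 * r\<^sup>2 \<le> 2 * \<beta> * n\<^sup>2 * r"
      by (intro mult_left_mono) (use \<beta> in auto)
    have "\<alpha> * r\<^sup>2 \<le> 1 * 1" using \<alpha> r2 by (intro mult_mono) auto
    then show "(1 + \<alpha> * r\<^sup>2) * s \<le> 2 * s" by (intro mult_right_mono s) simp
  qed
  finally have main: "r * n * (q - \<beta> * n) \<le> s"
    by (simp add: algebra_simps power2_eq_square)

  \<comment> \<open>from the decomposition \<open>1 + \<alpha> * a = \<kappa> * (1 + a) + \<beta> * (1 - a)\<close>\<close>
  have "q\<^sup>2 = \<beta>\<^sup>2 * n\<^sup>2 + \<kappa>\<^sup>2 * m\<^sup>2 + 2 * \<beta> * \<kappa> * s"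
    unfolding q_def n_def m_def s_def cmod_power2 \<beta>_def \<kappa>_def
    by (simp add: power2_eq_square field_simps)
  then have q2: "\<kappa>\<^sup>2 * m\<^sup>2 \<le> q\<^sup>2 - (\<beta> * n)\<^sup>2"
    using \<beta> \<kappa> s by (simp add: power_mult_distrib)
  then have "(\<beta> * n)\<^sup>2 \<le> q\<^sup>2"
    using mult_nonneg_nonneg[OF zero_le_power2[of \<kappa>] zero_le_power2[of m]] by linarith
  then have qn: "\<beta> * n \<le> q"
    by (rule power2_le_imp_le) (simp add: q_def)
  have "norm (\<alpha> * a) \<le> 1 * 1"
    unfolding norm_mult using \<alpha> a by (intro mult_mono) auto
  then have "q \<le> 2"
    unfolding q_def using norm_triangle_ineq[of 1 "\<alpha> * a"] by simp
  moreover have "n \<le> 2"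
    unfolding n_def using norm_triangle_ineq4[of 1 a] a by simp
  then have "\<beta> * n \<le> 1 * 2" using \<beta> n by (intro mult_mono) auto
  \<comment> \<open>Bounding the sum by 4 turns the difference of squares into a lower bound for
    \<open>q - \<beta> * n\<close>, which is what \<open>main\<close> controls.\<close>
  ultimately have "(q - \<beta> * n) * (q + \<beta> * n) \<le> (q - \<beta> * n) * 4"
    using qn by (intro mult_left_mono) auto
  with q2 have "\<kappa>\<^sup>2 * m\<^sup>2 \<le> (q - \<beta> * n) * 4"
    by (simp add: power2_eq_square algebra_simps)
  then have "r * n * (\<kappa>\<^sup>2 * m\<^sup>2) \<le> r * n * ((q - \<beta> * n) * 4)"
    using r n by (intro mult_left_mono) auto
  with main have "4 * (r * n * (\<kappa>\<^sup>2 * m\<^sup>2)) \<le> 16 * s" by (simp add: algebra_simps)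
  then show ?thesis
    by (simp add: n_def m_def s_def \<kappa>_def power2_eq_square field_simps)
qed

section \<open>Uniqueness from radial limits of bounded holomorphic functions\<close>

text \<open>The Cauchy integrals for \<open>g w\<close> over circles of radius tending to 1 all
  equal \<open>2 * pi * \<i> * g w\<close>, yet tend to 0 by dominated convergence.\<close>

lemma holomorphic_radial_limit_0_imp_0:
  assumes hol: "g holomorphic_on ball 0 1" and bd: "\<And>z. z \<in> ball 0 1 \<Longrightarrow> norm (g z) \<le> M"
    and lim: "AE t in lebesgue_on {0..2 * pi}. ((\<lambda>r. g (of_real r * cis t)) \<longlongrightarrow> 0) (at_left 1)"
    and w: "w \<in> ball 0 1"
  shows "g w = 0"
proof -
  define \<delta> where "\<delta> = 1 - norm w"
  have \<delta>: "0 < \<delta>" "\<delta> \<le> 1" using w by (auto simp: \<delta>_def)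
  \<comment> \<open>Starting at \<open>1 - \<delta> / 2\<close> keeps every circle at distance at
    least \<open>\<delta> / 2\<close> from \<open>w\<close>, uniformly in \<open>n\<close>; this
    yields a constant majorant.\<close>
  define r where "r = (\<lambda>n::nat. 1 - \<delta> / (2 * (real n + 1)))"
  have r: "1 - \<delta> / 2 \<le> r n" "r n < 1" for n
  proof -
    show "r n < 1" using \<delta> by (simp add: r_def)
    have "\<delta> / (2 * (real n + 1)) \<le> \<delta> / 2"
      using \<delta> by (intro divide_left_mono) auto
    then show "1 - \<delta> / 2 \<le> r n" by (simp add: r_def)
  qed
  have r0: "0 < r n" and rw: "\<delta> / 2 \<le> r n - norm w" for n
  proof -
    show "0 < r n" using r(1)[of n] \<delta> by linarith
    show "\<delta> / 2 \<le> r n - norm w" using r(1)[of n] by (simp add: \<delta>_def field_simps)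
  qed
  have "r \<longlonglongrightarrow> 1" unfolding r_def by real_asymp
  then have rlim: "filterlim r (at_left 1) sequentially"
    using r(2) by (auto simp: filterlim_at less_imp_neq)
  have M: "0 \<le> M" using bd[OF w] norm_ge_zero order_trans by blast
  \<comment> \<open>The Cauchy integrand pulled back to angles; \<open>r n * \<i> * cis t\<close> is
    the derivative of the parametrisation.\<close>
  define F where "F = (\<lambda>n t. g (r n * cis t) / (r n * cis t - w) * r n * \<i> * cis t)"
  have rc: "r n * cis t \<in> ball 0 1" for n t
    using r(2)[of n] r0[of n] by (simp add: norm_mult)
  have den: "\<delta> / 2 \<le> norm (r n * cis t - w)" for n t
    using norm_triangle_ineq2[of "r n * cis t" w] rw[of n] r0[of n] by (simp add: norm_mult)
  have den0: "r n * cis t - w \<noteq> 0" for n t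
    using den[of n t] \<delta> by auto
  have F_int: "(F n has_integral (2 * pi * \<i> * g w)) {0..2 * pi}" for n
  proof -
    have "((\<lambda>u. g u / (u - w)) has_contour_integral (2 * of_real pi * \<i> * g w)) (circlepath 0 (r n))"
    proof (rule Cauchy_integral_circlepath)
      have sub: "cball 0 (r n) \<subseteq> ball (0::complex) 1" using r(2)[of n] by auto
      show "continuous_on (cball 0 (r n)) g"
        using hol sub by (meson holomorphic_on_imp_continuous_on continuous_on_subset)
      show "g holomorphic_on ball 0 (r n)"
        using hol sub by (meson holomorphic_on_subset ball_subset_cball order_trans)
      show "norm (w - 0) < r n" using rw[of n] \<delta> by simp
    qed
    then show ?thesis
      unfolding circlepath_def F_def
      by (subst (asm) has_contour_integral_part_circlepath_iff) (auto simp: cis_conv_exp mult_ac)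
  qed
  have F_cont: "continuous_on {0..2 * pi} (F n)" for n
  proof -
    have "continuous_on {0..2 * pi} (\<lambda>t. g (r n * cis t))"
      using rc[of n]
      by (intro continuous_on_compose2[OF holomorphic_on_imp_continuous_on[OF hol]]
            continuous_intros) auto
    then show ?thesis
      unfolding F_def by (intro continuous_intros) (use den0 in auto)
  qed
  have F_meas: "F n \<in> borel_measurable (lebesgue_on {0..2 * pi})" for n
    using F_cont by (rule continuous_imp_measurable_on_sets_lebesgue) auto
  have F_bound: "norm (F n t) \<le> M / (\<delta> / 2)" for n t
  proof -
    have "norm (F n t) = norm (g (r n * cis t)) / norm (r n * cis t - w) * r n"
      using r0[of n] by (simp add: F_def norm_mult norm_divide)
    also have "\<dots> \<le> M / (\<delta> / 2) * 1"
      using bd[OF rc] den \<delta> M r0[of n] r(2)[of n]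
      by (intro mult_mono frac_le) (auto intro: less_imp_le)
    finally show ?thesis by simp
  qed
  have F_lim: "AE t in lebesgue_on {0..2 * pi}. (\<lambda>n. F n t) \<longlonglongrightarrow> 0"
    using lim
  proof eventually_elim
    case (elim t)
    have g0: "(\<lambda>n. g (r n * cis t)) \<longlonglongrightarrow> 0"
      using filterlim_compose[OF elim rlim] .
    show ?case
    proof (rule Lim_null_comparison)
      show "\<forall>\<^sub>F n in sequentially. norm (F n t) \<le> norm (g (r n * cis t)) / (\<delta> / 2) * 1"
      proof (rule always_eventually, rule allI)
        fix n
        have "norm (F n t) = norm (g (r n * cis t)) / norm (r n * cis t - w) * r n"
          using r0[of n] by (simp add: F_def norm_mult norm_divide)
        also have "\<dots> \<le> norm (g (r n * cis t)) / (\<delta> / 2) * 1"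
          using den \<delta> r0[of n] r(2)[of n]
          by (intro mult_mono frac_le) (auto intro: less_imp_le)
        finally show "norm (F n t) \<le> norm (g (r n * cis t)) / (\<delta> / 2) * 1" .
      qed
      show "(\<lambda>n. norm (g (r n * cis t)) / (\<delta> / 2) * 1) \<longlonglongrightarrow> 0"
        using tendsto_mult_left_zero[OF tendsto_norm_zero[OF g0], of "inverse (\<delta> / 2)"]
        by (simp add: field_simps)
    qed
  qed
  have "(\<lambda>n. integral\<^sup>L (lebesgue_on {0..2 * pi}) (F n))
      \<longlonglongrightarrow> integral\<^sup>L (lebesgue_on {0..2 * pi}) (\<lambda>_. 0)"
    using F_lim F_meas F_bound
    by (intro integral_dominated_convergence[where w = "\<lambda>_. M / (\<delta> / 2)"]) auto
  moreover have "integral\<^sup>L (lebesgue_on {0..2 * pi}) (F n) = 2 * pi * \<i> * g w" for n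
  proof -
    have "integrable (lebesgue_on {0..2 * pi}) (F n)"
      using F_cont by (rule continuous_imp_integrable_real[unfolded o_def])
    then show ?thesis
      using F_int[of n] by (simp add: lebesgue_integral_eq_integral integral_unique)
  qed
  ultimately show ?thesis by (simp add: LIMSEQ_const_iff)
qed

section \<open>Membership in \<open>P_class\<close> and its consequences\<close>

lemma h_fun_holomorphic:
  "h_fun \<alpha> holomorphic_on unit_disc"
  unfolding h_fun_def using norm_lt_1_imp_neq(1)
  by (intro holomorphic_intros) auto

lemma h_fun_schwarz_in_P_class:
  assumes "schwarz_function v" and "\<And>z. z \<in> unit_disc \<Longrightarrow> f z = h_fun \<alpha> (v z)"
  shows "f \<in> P_class \<alpha>"
proof -
  have "(h_fun \<alpha> \<circ> v) holomorphic_on unit_disc"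
    using assms(1) unfolding schwarz_function_def
    by (intro holomorphic_on_compose_gen[OF _ h_fun_holomorphic]) auto
  then have "f holomorphic_on unit_disc"
    using assms(2) by (subst holomorphic_cong[OF refl, of _ _ "h_fun \<alpha> \<circ> v"]) auto
  then show ?thesis
    using assms unfolding P_class_def subordinate_def by blast
qed

text \<open>This half-plane condition is what contradicts preservation when \<open>\<phi>\<close> is
  nonzero: it is applied to images of rotated copies of \<open>h_fun \<alpha>\<close>.\<close>

lemma Re_P_class_ge:
  fixes \<alpha> :: real
  assumes "-1 \<le> \<alpha>" and "f \<in> P_class \<alpha>" and "z \<in> unit_disc"
  shows "(1 - \<alpha>) / 2 \<le> Re (f z)"
proof -
  obtain v where "schwarz_function v" and f: "\<forall>z\<in>unit_disc. f z = h_fun \<alpha> (v z)"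
    using assms(2) unfolding P_class_def subordinate_def by blast
  then have "norm (v z) < 1"
    using assms(3) unfolding schwarz_function_def by fastforce
  then show ?thesis
    using Re_h_fun_ge[OF assms(1)] f assms(3) by simp
qed

lemma P_class_at_0:
  assumes "f \<in> P_class \<alpha>"
  shows "f 0 = 1"
  using assms unfolding P_class_def subordinate_def schwarz_function_def h_fun_def by force

theorem theorem3:
  fixes \<alpha> :: real and \<phi> \<omega> \<psi> :: "complex \<Rightarrow> complex"
  assumes "\<bar>\<alpha>\<bar> \<le> 1" and "\<alpha> \<noteq> -1"
    and "schwarz_function \<phi>" and "schwarz_function \<omega>" and "inner_function \<omega>"
    and "\<forall>z\<in>unit_disc. \<psi> z = (1 + complex_of_real \<alpha> * \<omega> z) / (1 - \<omega> z)"
  shows "preserves_P_class \<psi> \<phi> (complex_of_real \<alpha>) \<longleftrightarrow> (\<forall>z\<in>unit_disc. \<phi> z = 0)"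
proof
  have \<psi>: "\<psi> z = h_fun \<alpha> (\<omega> z)" if "z \<in> unit_disc" for z
    using assms(6) that by (simp add: h_fun_def)
  {
    assume \<phi>0: "\<forall>z\<in>unit_disc. \<phi> z = 0"
    show "preserves_P_class \<psi> \<phi> \<alpha>"
      unfolding preserves_P_class_def
    \<comment> \<open>As \<open>f 0 = 1\<close>, every image function is \<open>\<psi>\<close> on
      the disc, and \<open>\<omega>\<close> itself is the Schwarz function required.\<close>
    proof (intro image_subsetI h_fun_schwarz_in_P_class[OF assms(4)])
      fix f z assume "f \<in> P_class \<alpha>" "z \<in> unit_disc"
      then show "weighted_comp \<psi> \<phi> f z = h_fun \<alpha> (\<omega> z)"
        using \<phi>0 \<psi> by (simp add: weighted_comp_def P_class_at_0)
    qed
  }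
  assume pres: "preserves_P_class \<psi> \<phi> \<alpha>"
  have \<omega>1: "norm (\<omega> z) < 1" and \<phi>1: "norm (\<phi> z) < 1" if "z \<in> unit_disc" for z
    using assms(3,4) that unfolding schwarz_function_def by fastforce+
  have \<omega>_hol: "\<omega> holomorphic_on unit_disc" and \<phi>_hol: "\<phi> holomorphic_on unit_disc"
    using assms(3,4) by (auto simp: schwarz_function_def)
  define g where "g = (\<lambda>z. \<phi> z * (1 - \<omega> z) * (1 + \<omega> z)\<^sup>2)"
  have bound: "(1 + \<alpha>)\<^sup>2 * norm (g z) \<le> 16 * (1 - (norm (\<omega> z))\<^sup>2)" if z: "z \<in> unit_disc" for z
  proof (cases "\<phi> z = 0")
    case True
    then show ?thesis using \<omega>1[OF z] by (simp add: g_def abs_square_le_1)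
  next
    case False
    have "(1 + \<alpha>)\<^sup>2 * (norm (\<phi> z) * norm (1 - \<omega> z) * (norm (1 + \<omega> z))\<^sup>2)
        \<le> 16 * (1 - (norm (\<omega> z))\<^sup>2)"
    proof (rule h_fun_product_bound[OF assms(1,2) \<omega>1[OF z] norm_ge_zero \<phi>1[OF z]])
      fix w :: complex assume w: "norm w = norm (\<phi> z)"
      \<comment> \<open>The rotation depends on the point \<open>z\<close>: it is chosen so that
        \<open>\<eta> * \<phi> z = w\<close>, hence the separate case
        \<open>\<phi> z = 0\<close>.\<close>
      define \<eta> where "\<eta> = w / \<phi> z"
      have "norm \<eta> = 1" using w False by (simp add: \<eta>_def norm_divide)
      then have "schwarz_function (\<lambda>z. \<eta> * z)"
        by (auto simp: schwarz_function_def norm_mult intro!: holomorphic_intros)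
      then have "(\<lambda>z. h_fun \<alpha> (\<eta> * z)) \<in> P_class \<alpha>"
        by (rule h_fun_schwarz_in_P_class) simp
      then have "weighted_comp \<psi> \<phi> (\<lambda>z. h_fun \<alpha> (\<eta> * z)) \<in> P_class \<alpha>"
        using pres unfolding preserves_P_class_def by blast
      from Re_P_class_ge[OF _ this z]
      show "(1 - \<alpha>) / 2 \<le> Re (h_fun \<alpha> (\<omega> z) * h_fun \<alpha> w)"
        using assms(1) False \<psi>[OF z] by (simp add: weighted_comp_def \<eta>_def abs_le_iff)
    qed
    then show ?thesis by (simp add: g_def norm_mult norm_power)
  qed
  define C where "C = 16 / (1 + \<alpha>)\<^sup>2"
  have "0 < (1 + \<alpha>)\<^sup>2" using assms(2) by simp
  then have gC: "norm (g z) \<le> C * (1 - (norm (\<omega> z))\<^sup>2)" if "z \<in> unit_disc" for z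
    using bound[OF that] by (simp add: C_def field_simps)
  have "C \<ge> 0" by (simp add: C_def)
  have "g z = 0" if "z \<in> unit_disc" for z
  proof (rule holomorphic_radial_limit_0_imp_0[OF _ _ _ that])
    show "g holomorphic_on unit_disc"
      unfolding g_def by (intro holomorphic_intros \<omega>_hol \<phi>_hol)
    show "norm (g z) \<le> C" if "z \<in> unit_disc" for z
    proof -
      have "C * (1 - (norm (\<omega> z))\<^sup>2) \<le> C * 1"
        using \<open>C \<ge> 0\<close> by (intro mult_left_mono) auto
      then show ?thesis using gC[OF that] by simp
    qed
    show "AE t in lebesgue_on {0..2 * pi}. ((\<lambda>r. g (of_real r * cis t)) \<longlongrightarrow> 0) (at_left 1)"
      using assms(5)[unfolded inner_function_def, THEN conjunct2, THEN conjunct2]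
    proof eventually_elim
      case (elim t)
      then obtain l where l: "((\<lambda>r. \<omega> (of_real r * cis t)) \<longlongrightarrow> l) (at_left 1)" "norm l = 1"
        by blast
      show ?case
      proof (rule Lim_null_comparison)
        have "\<forall>\<^sub>F r in at_left (1::real). r \<in> {0<..<1}"
          by (rule eventually_at_left_real) simp
        then show "\<forall>\<^sub>F r in at_left 1. norm (g (of_real r * cis t))
            \<le> C * (1 - (norm (\<omega> (of_real r * cis t)))\<^sup>2)"
          by eventually_elim (rule gC, simp add: norm_mult)
        \<comment> \<open>Innerness enters here: \<open>norm l = 1\<close> makes the majorant vanish
          in the limit.\<close>
        have "((\<lambda>r. C * (1 - (norm (\<omega> (of_real r * cis t)))\<^sup>2)) \<longlongrightarrow> C * (1 - (norm l)\<^sup>2)) (at_left 1)"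
          by (intro tendsto_intros l)
        then show "((\<lambda>r. C * (1 - (norm (\<omega> (of_real r * cis t)))\<^sup>2)) \<longlongrightarrow> 0) (at_left 1)"
          using l(2) by simp
      qed
    qed
  qed
  then show "\<forall>z\<in>unit_disc. \<phi> z = 0"
    using norm_lt_1_imp_neq \<omega>1 unfolding g_def
    by (metis mult_eq_0_iff power_not_zero)
qed

end
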